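(* Let $n\ge 5$ and $k\ge 0$ be integers with $k\le n-2$ if $n$ is even, and $k\le n-3$ if $n$ is odd. Then for every integer $r$ with $2\le r\le n$, \[ M(n,k,r)\le M(n,k,2). \]
   Context: All graphs are finite and simple. For a vertex $u$ of a graph $G$, $N[u]$ is its closed neighborhood (the set consisting of $u$ and all vertices adjacent to $u$). A set $S\subseteq V(G)$ is dominating if every vertex of $G$ lies in $N[s]$ for some $s\in S$. A vertex $u\in V(G)$ is overdominated by $S$ if $|N[u]\cap S|\ge 2$. The cardinality-redundance $CR(S)$ is the number of vertices of $G$ overdominated by $S$, and $CR(G)$ is the minimum of $CR(S)$ over all dominating sets $S$ of $G$. $\gamma_{CR}(G)$ is the minimum size of a dominating set $S$ with $CR(S)=CR(G)$. For integers $k\ge 0$ and $n,r\ge 1$ with $k\le n$, $r\le n$, $M(n,k,r)$ is the maximum of $|E(G)|$ over all graphs $G$ with $|V(G)|=n$, $CR(G)=k$ and $\gamma_{CR}(G)=r$; if no such graph exists, $M(n,k,r)=0$. *)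

theory Defs
  imports "Graph_Theory.Pair_Digraph"
begin

text \<open>
  A finite simple graph is a \<^locale>\<open>pair_graph\<close>: a finite, loop-free, symmetric set
  of vertex pairs. Both orientations of an edge are arcs, so edges are recovered as
  unordered pairs.
\<close>

definition uedges :: "'a pair_pre_digraph \<Rightarrow> 'a set set" where
  "uedges G = {{u, v} | u v. (u, v) \<in> parcs G}"

definition closed_nbhd :: "'a pair_pre_digraph \<Rightarrow> 'a \<Rightarrow> 'a set" where
  "closed_nbhd G u = insert u {v \<in> pverts G. (u, v) \<in> parcs G}"

definition dominating :: "'a pair_pre_digraph \<Rightarrow> 'a set \<Rightarrow> bool" where
  "dominating G S \<longleftrightarrow> S \<subseteq> pverts G \<and> (\<forall>v \<in> pverts G. \<exists>s \<in> S. v \<in> closed_nbhd G s)"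

definition overdominated :: "'a pair_pre_digraph \<Rightarrow> 'a set \<Rightarrow> 'a \<Rightarrow> bool" where
  "overdominated G S u \<longleftrightarrow> u \<in> pverts G \<and> card (closed_nbhd G u \<inter> S) \<ge> 2"

definition CR_set :: "'a pair_pre_digraph \<Rightarrow> 'a set \<Rightarrow> nat" where
  "CR_set G S = card {u \<in> pverts G. overdominated G S u}"

text \<open>
  The two minima below are over finite nonempty sets, since the vertex set of a finite
  graph is dominating.
\<close>

definition CR :: "'a pair_pre_digraph \<Rightarrow> nat" where
  "CR G = Min {CR_set G S | S. dominating G S}"

definition gamma_CR :: "'a pair_pre_digraph \<Rightarrow> nat" where
  "gamma_CR G = Min {card S | S. dominating G S \<and> CR_set G S = CR G}"

text \<open>
  All invariants are isomorphism-invariant and every finite graph has a copy with vertices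
  in \<^typ>\<open>nat\<close>, so ranging over these graphs covers all finite graphs. The edge counts
  form a finite set, being bounded by \<open>n choose 2\<close>.
\<close>

definition M_graphs :: "nat \<Rightarrow> nat \<Rightarrow> nat \<Rightarrow> nat pair_pre_digraph set" where
  "M_graphs n k r =
     {G. pair_graph G \<and> card (pverts G) = n \<and> CR G = k \<and> gamma_CR G = r}"

definition M :: "nat \<Rightarrow> nat \<Rightarrow> nat \<Rightarrow> nat" where
  "M n k r =
     (if M_graphs n k r = {} then 0 else Max {card (uedges G) | G. G \<in> M_graphs n k r})"

end

theory Submission
  imports Defs
begin

text \<open>
  The argument works in the complement of a graph \<open>G\<close> of order \<open>n\<close>. Put \<open>d = n - k\<close>. A set \<open>S\<close> is
  dominating if and only if no vertex is adjacent in the complement to all of \<open>S\<close>, and a vertex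
  is then not overdominated if and only if it has exactly \<open>|S| - 1\<close> complement neighbours in
  \<open>S\<close>. So \<open>CR(G) = k\<close> says that at most \<open>d\<close> vertices are of this kind, for every dominating
  \<open>S\<close>, with equality for some \<open>S\<close>.
  
  If \<open>\<gamma>\<^sub>C\<^sub>R(G) = r \<ge> 2\<close>, then there is no universal vertex, so all complement degrees are positive;
  counting complement edges at an optimal set of size \<open>r\<close> shows that the sum of the complement
  degrees is at least \<open>d (r - 1) + (n - r)\<close> (\<open>conbhd_sum_ge\<close>). For \<open>r \<ge> 3\<close> this is at least
  \<open>n - 1 + 2 (d - 1) \<ge> n - 1 + d\<close>, since \<open>d \<ge> 2\<close>.
  
  On the other hand, there are graphs with redundancy \<open>k\<close> and \<open>\<gamma>\<^sub>C\<^sub>R = 2\<close> whose complement has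
  degree sum at most \<open>n - 1 + d\<close>. If \<open>n - d\<close> is even, the complement is a star with \<open>d\<close>
  vertices together with a matching (\<open>star_matching_graph\<close>); if \<open>n - d\<close> is odd and \<open>d \<ge> 4\<close>, it
  is a star with two legs extended together with a matching (\<open>spider_matching_graph\<close>).
  
  What remains is \<open>d = 3\<close> with \<open>n\<close> even, and here no graph has \<open>\<gamma>\<^sub>C\<^sub>R \<ge> 3\<close>
  (\<open>gamma_ge_3_imp_odd\<close>). In such a graph any two vertices with complement degree sum at least
  3 have a common complement neighbour, and this extends to all pairs. Because no dominating
  set dominates more than three vertices once, any two elements of a triple without a common
  complement neighbour have exactly one common complement neighbour. As in the friendship
  theorem, it follows that in the complement any two vertices have exactly one common
  neighbour and all degrees are even, which makes the number of vertices odd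
  (\<open>scattered_imp_odd_card\<close>).
\<close>

section \<open>Graphs in which any two vertices have a common neighbour\<close>

text \<open>
  A loop-free graph on \<^term>\<open>V\<close>, given by its neighbourhood function, in which any two vertices
  have a common neighbour, and have only one if some third vertex is adjacent to none of
  their common neighbours. It will be the complement of a graph with
  \<open>CR = n - 3\<close> and \<open>\<gamma>\<^sub>C\<^sub>R \<ge> 3\<close>.
\<close>

locale meeting_graph =
  fixes V :: "'a set" and N :: "'a \<Rightarrow> 'a set"
  assumes finite_V: "finite V"
    and N_sub: "v \<in> V \<Longrightarrow> N v \<subseteq> V"
    and N_irrefl: "v \<in> V \<Longrightarrow> v \<notin> N v"
    and N_sym: "u \<in> V \<Longrightarrow> v \<in> V \<Longrightarrow> u \<in> N v \<Longrightarrow> v \<in> N u"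
    and N_meet: "u \<in> V \<Longrightarrow> v \<in> V \<Longrightarrow> u \<noteq> v \<Longrightarrow> N u \<inter> N v \<noteq> {}"
    and N_triple: "\<lbrakk>x \<in> V; y \<in> V; z \<in> V; x \<noteq> y; y \<noteq> z; x \<noteq> z; N x \<inter> N y \<inter> N z = {}\<rbrakk>
                    \<Longrightarrow> card (N x \<inter> N y) = 1"
begin

text \<open>
  Three distinct vertices without a neighbour common to all of them.
\<close>

definition scattered :: "'a \<Rightarrow> 'a \<Rightarrow> 'a \<Rightarrow> bool" where
  "scattered a b c \<longleftrightarrow> a \<in> V \<and> b \<in> V \<and> c \<in> V \<and> a \<noteq> b \<and> b \<noteq> c \<and> a \<noteq> c \<and>
     N a \<inter> N b \<inter> N c = {}"

lemma scattered_swap: "scattered a b c \<Longrightarrow> scattered b a c"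
  and scattered_rotate: "scattered a b c \<Longrightarrow> scattered b c a"
  unfolding scattered_def by blast+

lemma scattered_unique: "scattered a b c \<Longrightarrow> \<exists>p. N a \<inter> N b = {p}"
  unfolding scattered_def by (metis N_triple card_1_singletonE)

lemma scattered_two_traces:
  assumes "scattered a b c"
  obtains p r where "p \<noteq> r" "N b \<inter> N a = {p}" "N c \<inter> N a = {r}"
proof -
  obtain p where p: "N b \<inter> N a = {p}"
    using scattered_unique[OF scattered_swap[OF assms]] by blast
  obtain r where r: "N c \<inter> N a = {r}"
    using scattered_unique[OF scattered_rotate[OF scattered_rotate[OF assms]]] by blast
  have "p \<in> N b" "p \<in> N a" "r \<in> N c" using p r by auto
  then have "p \<noteq> r"
    using assms unfolding scattered_def by blast
  with p r that show thesis by blast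
qed

text \<open>
  The trace of a vertex \<^term>\<open>y\<close> on the neighbourhood of \<^term>\<open>a\<close> is the set of their common
  neighbours. Collected here are the points that form the whole trace of some vertex.
\<close>

definition singleton_traces :: "'a \<Rightarrow> 'a set" where
  "singleton_traces a = {p. \<exists>y\<in>V. y \<noteq> a \<and> N y \<inter> N a = {p}}"

text \<open>
  Disjoint traces of \<open>x\<close> and \<open>y\<close> make \<open>x, a, y\<close> scattered, so both are singletons. Hence a trace
  with more than one point meets every singleton trace.
\<close>

lemma trace_cases:
  assumes "a \<in> V" "x \<in> V" "x \<noteq> a"
  shows "(\<exists>p\<in>singleton_traces a. N x \<inter> N a = {p}) \<or> singleton_traces a \<subseteq> N x"
proof (rule disjCI)
  assume no: "\<not> singleton_traces a \<subseteq> N x"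
  then obtain p y where y: "y \<in> V" "y \<noteq> a" "N y \<inter> N a = {p}" "p \<notin> N x"
    unfolding singleton_traces_def by blast
  have "N x \<inter> N a \<inter> N y = N x \<inter> {p}" using y(3) by (metis Int_assoc Int_commute)
  then have "scattered x a y"
    using assms y unfolding scattered_def by auto
  then obtain q where "N x \<inter> N a = {q}"
    using scattered_unique by blast
  then show "\<exists>p\<in>singleton_traces a. N x \<inter> N a = {p}"
    unfolding singleton_traces_def using assms by blast
qed

text \<open>
  If \<open>a\<close> lies in a scattered triple, its neighbourhood induces a perfect matching. A
  neighbour \<open>u\<close> of \<open>a\<close> is not in its own trace; this rules out large traces for the points of
  \<^term>\<open>singleton_traces a\<close>, and then shows that every neighbour is such a point.
\<close>

lemma scattered_nbhd:
  assumes "scattered a b c"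
  shows "singleton_traces a = N a"
    and "u \<in> N a \<Longrightarrow> \<exists>w. N u \<inter> N a = {w}"
proof -
  have aV: "a \<in> V" using assms unfolding scattered_def by blast
  have sub: "singleton_traces a \<subseteq> N a" unfolding singleton_traces_def by blast
  obtain p where "N b \<inter> N a = {p}" using scattered_unique[OF scattered_swap[OF assms]] by blast
  then have p: "p \<in> singleton_traces a"
    using assms unfolding singleton_traces_def scattered_def by (auto intro!: bexI[of _ b])
  have sing: "\<exists>w\<in>singleton_traces a. N q \<inter> N a = {w}" if "q \<in> singleton_traces a" for q
    using trace_cases[OF aV, of q] that sub N_irrefl N_sub aV by blast
  have all: "u \<in> singleton_traces a" if u: "u \<in> N a" for u
  proof -
    have uV: "u \<in> V" "u \<noteq> a" using u aV N_sub N_irrefl by blast+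
    obtain q where q: "q \<in> singleton_traces a" "q \<in> N u"
      using trace_cases[OF aV uV] p by blast
    then have "u \<in> N q \<inter> N a"
      using u uV sub N_sub aV N_sym by blast
    moreover obtain w where "w \<in> singleton_traces a" "N q \<inter> N a = {w}"
      using sing[OF q(1)] by metis
    ultimately show ?thesis by simp
  qed
  then show eq: "singleton_traces a = N a" using sub by blast
  show "\<exists>w. N u \<inter> N a = {w}" if "u \<in> N a" for u
    using sing that eq by blast
qed

lemma trace_dichotomy:
  assumes "scattered a b c" "x \<in> V" "x \<noteq> a"
  shows "(\<exists>p. N x \<inter> N a = {p}) \<or> N a \<subseteq> N x"
  using trace_cases[OF _ assms(2,3)] scattered_nbhd(1)[OF assms(1)] assms(1)
  unfolding scattered_def by metis

lemma unscattered_superset: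
  assumes abc: "scattered a b c" and x: "x \<in> V" "\<And>y z. \<not> scattered x y z"
  shows "N a \<subseteq> N x"
proof -
  obtain p r where pr: "p \<noteq> r" "N b \<inter> N a = {p}" "N c \<inter> N a = {r}"
    using scattered_two_traces[OF abc] .
  have V: "a \<in> V" "b \<in> V" "c \<in> V" "a \<noteq> b" "a \<noteq> c" using abc unfolding scattered_def by auto
  have xne: "x \<noteq> a" "x \<noteq> b" "x \<noteq> c"
    using abc x(2) scattered_rotate[OF abc] scattered_swap[OF abc]
      scattered_rotate[OF scattered_rotate[OF abc]] by metis+
  have "N x \<inter> N b \<inter> N a \<noteq> {}" "N x \<inter> N c \<inter> N a \<noteq> {}"
    using x(2)[of b a] x(2)[of c a] V x(1) xne unfolding scattered_def by simp_all
  then have "p \<in> N x" "r \<in> N x"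
    unfolding Int_assoc pr by simp_all
  moreover have "p \<in> N a" "r \<in> N a" using pr by auto
  ultimately have "\<not> (\<exists>p. N x \<inter> N a = {p})" using pr(1) by (metis IntI singletonD)
  then show ?thesis using trace_dichotomy[OF abc x(1) xne(1)] by blast
qed

text \<open>
  A vertex \<open>x\<close> in no scattered triple is adjacent to all neighbours of all scattered
  vertices. A neighbour \<open>u\<close> of \<open>a\<close> would be adjacent to itself if it were in no scattered
  triple; so it is in one, and its neighbour \<open>x\<close> is adjacent to itself.
\<close>

lemma all_scattered:
  assumes abc: "scattered a b c" and x: "x \<in> V"
  shows "\<exists>y z. scattered x y z"
proof (rule ccontr)
  assume nx: "\<nexists>y z. scattered x y z"
  have aV: "a \<in> V" and "b \<in> V" "a \<noteq> b" using abc unfolding scattered_def by auto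
  then obtain u where u: "u \<in> N a" using N_meet by blast
  have uV: "u \<in> V" using u aV N_sub by blast
  have ux: "u \<in> N x" using unscattered_superset[OF abc x] nx u by blast
  have "\<exists>y z. scattered u y z"
    using unscattered_superset[OF abc uV] u N_irrefl[OF uV] by (metis subsetD)
  then obtain y z where "scattered u y z" by blast
  then have "N u \<subseteq> N x" using unscattered_superset[OF _ x] nx by metis
  then show False using ux N_sym[OF uV x] N_irrefl[OF x] by blast
qed

text \<open>
  The alternative is that \<open>x\<close> and \<open>y\<close> have the same neighbourhood. Then for a common
  neighbour \<open>u\<close> no trace on the neighbourhood of \<open>u\<close> could consist of \<open>x\<close> alone, contrary to
  \<open>scattered_nbhd\<close>.
\<close>

lemma unique_common_nbr:
  assumes abc: "scattered a b c" and xy: "x \<in> V" "y \<in> V" "x \<noteq> y"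
  shows "\<exists>p. N x \<inter> N y = {p}"
proof (rule ccontr)
  assume no: "\<nexists>p. N x \<inter> N y = {p}"
  obtain x1 x2 y1 y2 where s: "scattered x x1 x2" "scattered y y1 y2"
    using all_scattered[OF abc xy(1)] all_scattered[OF abc xy(2)] by metis
  have "N x \<subseteq> N y"
    using trace_dichotomy[OF s(1) xy(2)] no xy(3) by (metis Int_commute)
  moreover have "N y \<subseteq> N x"
    using trace_dichotomy[OF s(2) xy(1)] no xy(3) by metis
  ultimately have eq: "N x = N y" by (rule subset_antisym)
  obtain u where u: "u \<in> N x" "u \<in> N y" using N_meet xy by blast
  have uV: "u \<in> V" using u N_sub xy by blast
  have xu: "x \<in> N u" "y \<in> N u" using N_sym u uV xy by blast+
  obtain u1 u2 where "scattered u u1 u2" using all_scattered[OF abc uV] by metis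
  then have "x \<in> singleton_traces u" using scattered_nbhd(1) xu(1) by metis
  then obtain z where z: "z \<in> V" "N z \<inter> N u = {x}"
    unfolding singleton_traces_def by blast
  then have "z \<in> N y" using N_sym[of x z] eq xy by blast
  then have "y \<in> N z \<inter> N u" using N_sym z xy xu by blast
  then show False unfolding z(2) using xy by simp
qed

lemma even_degree:
  assumes abc: "scattered a b c"
  shows "even (card (N a))"
proof -
  have aV: "a \<in> V" using abc unfolding scattered_def by blast
  have fin: "finite (N a)" using finite_subset[OF N_sub[OF aV] finite_V] .
  \<comment> \<open>the partner of \<^term>\<open>u\<close> in the perfect matching on \<^term>\<open>N a\<close>\<close>
  define m where "m u = (THE w. N u \<inter> N a = {w})" for u
  have m: "N u \<inter> N a = {m u}" if u: "u \<in> N a" for u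
  proof -
    obtain w where "N u \<inter> N a = {w}" using scattered_nbhd(2)[OF abc u] by blast
    then show ?thesis unfolding m_def by simp
  qed
  have mN: "m u \<in> N a" "m u \<in> N u" if "u \<in> N a" for u using m[OF that] by blast+
  have mm: "m (m u) = u" if "u \<in> N a" for u
  proof -
    have "u \<in> N (m u)" using mN[OF that] N_sym that N_sub aV by blast
    then have "u \<in> N (m u) \<inter> N a" using that by blast
    then show ?thesis using m[OF mN(1)[OF that]] by simp
  qed
  have "m u \<noteq> u" if "u \<in> N a" for u using mN[OF that] that N_irrefl N_sub aV by force
  then have pair: "card {u, m u} = 2" if "u \<in> N a" for u using that by force
  have "card (\<Union>((\<lambda>u. {u, m u}) ` N a)) = sum card ((\<lambda>u. {u, m u}) ` N a)"
  proof (rule card_Union_disjoint)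
    show "pairwise disjnt ((\<lambda>u. {u, m u}) ` N a)"
    proof (rule pairwiseI)
      fix X Y assume "X \<in> (\<lambda>u. {u, m u}) ` N a" "Y \<in> (\<lambda>u. {u, m u}) ` N a" and ne: "X \<noteq> Y"
      then obtain u w where uw: "u \<in> N a" "X = {u, m u}" "w \<in> N a" "Y = {w, m w}" by blast
      then have "u \<noteq> w" "u \<noteq> m w" "m u \<noteq> w" using ne mm by auto
      moreover have "m u \<noteq> m w" using mm uw \<open>u \<noteq> w\<close> by metis
      ultimately show "disjnt X Y" using uw by (simp add: disjnt_def)
    qed
  qed auto
  moreover have "\<Union>((\<lambda>u. {u, m u}) ` N a) = N a" using mN by blast
  ultimately have "card (N a) = sum card ((\<lambda>u. {u, m u}) ` N a)" by simp
  also have "\<dots> = sum (\<lambda>_. 2) ((\<lambda>u. {u, m u}) ` N a)"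
    by (rule sum.cong) (auto simp: pair)
  finally show ?thesis by simp
qed

text \<open>
  Every vertex other than \<open>a\<close> has a unique neighbour \<open>u\<close> among those of \<open>a\<close>, so the
  \<open>|V| - 1\<close> other vertices are counted by the sum of \<open>deg u - 1\<close> over the neighbours \<open>u\<close>: an
  even number of odd terms.
\<close>

lemma scattered_imp_odd_card:
  assumes abc: "scattered a b c"
  shows "odd (card V)"
proof -
  have aV: "a \<in> V" using abc unfolding scattered_def by blast
  have fin: "finite (N v)" if "v \<in> V" for v using finite_subset[OF N_sub[OF that] finite_V] .
  have ev: "even (card (N v))" if "v \<in> V" for v
    using all_scattered[OF abc that] even_degree by metis
  have "V - {a} = (\<Union>u\<in>N a. N u - {a})"
  proof (intro equalityI subsetI)
    fix x assume x: "x \<in> V - {a}"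
    then obtain u where "u \<in> N a" "u \<in> N x" using N_meet[of a x] aV by blast
    then show "x \<in> (\<Union>u\<in>N a. N u - {a})" using x N_sym N_sub aV by blast
  qed (use N_sub aV in blast)
  moreover have "(N u - {a}) \<inter> (N w - {a}) = {}" if "u \<in> N a" "w \<in> N a" "u \<noteq> w" for u w
  proof (rule ccontr)
    assume "(N u - {a}) \<inter> (N w - {a}) \<noteq> {}"
    then obtain x where x: "x \<in> N u" "x \<in> N w" "x \<noteq> a" by blast
    have "u \<in> V" "w \<in> V" "x \<in> V" using that N_sub aV x by blast+
    then have "u \<in> N x \<inter> N a" "w \<in> N x \<inter> N a" using that N_sym x by blast+
    moreover obtain p where "N x \<inter> N a = {p}"
      using unique_common_nbr[OF abc \<open>x \<in> V\<close> aV x(3)] by blast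
    ultimately show False using that(3) by simp
  qed
  moreover have "\<forall>u\<in>N a. finite (N u - {a})" using fin N_sub aV by blast
  ultimately have "card (V - {a}) = (\<Sum>u\<in>N a. card (N u - {a}))"
    using card_UN_disjoint[OF fin[OF aV], of "\<lambda>u. N u - {a}"] by auto
  also have "even \<dots> \<longleftrightarrow> even (card (N a))"
  proof -
    have "odd (card (N u - {a}))" if "u \<in> N a" for u
    proof -
      have uV: "u \<in> V" using that N_sub aV by blast
      have "a \<in> N u" using that N_sym uV aV by blast
      then show ?thesis using ev[OF uV] fin[OF uV]
        by (metis card_Suc_Diff1 even_Suc)
    qed
    then have "{u \<in> N a. odd (card (N u - {a}))} = N a" by blast
    then show ?thesis using fin[OF aV] by (simp add: even_sum_iff)
  qed
  finally have "even (card (V - {a}))" using ev[OF aV] by simp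
  then show ?thesis using aV finite_V by (metis card_Suc_Diff1 even_Suc)
qed

end

section \<open>Redundancy in terms of the complement\<close>

text \<open>
  The neighbourhood of \<^term>\<open>v\<close> in the complement of \<^term>\<open>G\<close>.
\<close>

definition conbhd :: "'a pair_pre_digraph \<Rightarrow> 'a \<Rightarrow> 'a set" where
  "conbhd G v = pverts G - closed_nbhd G v"

text \<open>
  If \<^term>\<open>S\<close> is dominating, these are the vertices that are not overdominated: the difference
  is the intersection of \<^term>\<open>S\<close> with the closed neighbourhood of \<^term>\<open>v\<close>.
\<close>

definition once_dominated :: "'a pair_pre_digraph \<Rightarrow> 'a set \<Rightarrow> 'a set" where
  "once_dominated G S = {v \<in> pverts G. card (S - conbhd G v) = 1}"

lemma card_eq_1_obtain:
  assumes "card A = 1" obtains x where "A = {x}"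
  using assms card_1_singletonE by blast

context pair_graph
begin

lemma arc_commute: "(u, v) \<in> parcs G \<longleftrightarrow> (v, u) \<in> parcs G"
  using arcs_symmetric by blast

lemma mem_conbhd: "u \<in> conbhd G v \<longleftrightarrow> u \<in> pverts G \<and> u \<noteq> v \<and> (v, u) \<notin> parcs G"
  unfolding conbhd_def closed_nbhd_def by auto

lemma conbhd_subset: "conbhd G v \<subseteq> pverts G"
  unfolding conbhd_def by (rule Diff_subset)

lemma finite_conbhd: "finite (conbhd G v)"
  using finite_subset[OF conbhd_subset pair_finite_verts] .

lemma conbhd_irrefl: "v \<notin> conbhd G v"
  by (simp add: mem_conbhd)

lemma conbhd_sym: "u \<in> conbhd G v \<Longrightarrow> v \<in> pverts G \<Longrightarrow> v \<in> conbhd G u"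
  using arc_commute by (auto simp: mem_conbhd)

lemma dominating_iff:
  "dominating G S \<longleftrightarrow> S \<subseteq> pverts G \<and> (\<forall>v\<in>pverts G. \<not> S \<subseteq> conbhd G v)"
proof -
  have "v \<in> closed_nbhd G s \<longleftrightarrow> s \<notin> conbhd G v" if "v \<in> pverts G" "s \<in> pverts G" for v s
    using that arc_commute unfolding mem_conbhd closed_nbhd_def by auto
  then show ?thesis unfolding dominating_def by (meson subset_iff)
qed

lemma dominatingD:
  assumes "dominating G S"
  shows "S \<subseteq> pverts G" "finite S" "v \<in> pverts G \<Longrightarrow> \<not> S \<subseteq> conbhd G v"
  using assms finite_subset[OF _ pair_finite_verts] unfolding dominating_iff by auto

lemma finite_once_dominated: "finite (once_dominated G S)"
  unfolding once_dominated_def using pair_finite_verts by simp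

lemma CR_set_add_once:
  assumes "dominating G S"
  shows "CR_set G S + card (once_dominated G S) = card (pverts G)"
proof -
  have eq: "closed_nbhd G v \<inter> S = S - conbhd G v" for v
    using dominatingD(1)[OF assms] unfolding conbhd_def by auto
  have "card (S - conbhd G v) \<noteq> 0" if "v \<in> pverts G" for v
    using dominatingD[OF assms] that by simp
  then have "card (S - conbhd G v) = 1 \<longleftrightarrow> \<not> 2 \<le> card (S - conbhd G v)" if "v \<in> pverts G" for v
    using that by (metis One_nat_def Suc_1 le_Suc_eq less_2_cases not_less not_less_eq_eq)
  then have "once_dominated G S = {v \<in> pverts G. \<not> overdominated G S v}"
    unfolding once_dominated_def overdominated_def eq by auto
  moreover have "card {v \<in> pverts G. overdominated G S v} + card {v \<in> pverts G. \<not> overdominated G S v}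
      = card (pverts G)"
    using pair_finite_verts
    by (subst card_Un_disjoint[symmetric]) (auto intro!: arg_cong[where f = card])
  ultimately show ?thesis unfolding CR_set_def by simp
qed

lemma dominating_verts: "dominating G (pverts G)"
  unfolding dominating_iff using conbhd_irrefl by blast

lemma finite_dominating: "finite {S. dominating G S}"
  by (rule finite_subset[of _ "Pow (pverts G)"]) (use dominatingD(1) pair_finite_verts in auto)

lemma CR_le:
  assumes "dominating G S"
  shows "CR G \<le> CR_set G S"
  unfolding CR_def using assms finite_dominating by (intro Min_le) auto

lemma CR_attained: "\<exists>S. dominating G S \<and> CR_set G S = CR G"
proof -
  have "CR G \<in> {CR_set G S | S. dominating G S}"
    unfolding CR_def using dominating_verts finite_dominating by (intro Min_in) auto
  then show ?thesis by force
qed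

lemma gamma_CR_le:
  assumes "dominating G S" "CR_set G S = CR G"
  shows "gamma_CR G \<le> card S"
  unfolding gamma_CR_def using assms finite_dominating by (intro Min_le) auto

lemma gamma_CR_attained:
  obtains S where "dominating G S" "CR_set G S = CR G" "card S = gamma_CR G"
proof -
  have "gamma_CR G \<in> {card S | S. dominating G S \<and> CR_set G S = CR G}"
    unfolding gamma_CR_def using CR_attained finite_dominating by (intro Min_in) auto
  then show thesis using that by force
qed

lemma card_parcs: "card (parcs G) = 2 * card (uedges G)"
proof -
  have img: "uedges G = (\<lambda>(u, v). {u, v}) ` parcs G"
    unfolding uedges_def by auto
  have fib: "card {e \<in> parcs G. (case e of (u, v) \<Rightarrow> {u, v}) = X} = 2" if X: "X \<in> uedges G" for X
  proof -
    obtain u v where uv: "(u, v) \<in> parcs G" "X = {u, v}" using X unfolding uedges_def by blast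
    then have "u \<noteq> v" using pair_no_loops by fastforce
    moreover have "{e \<in> parcs G. (case e of (u, v) \<Rightarrow> {u, v}) = X} = {(u, v), (v, u)}"
      using uv arc_commute by (auto simp: doubleton_eq_iff)
    ultimately show ?thesis by simp
  qed
  have "card (parcs G) = (\<Sum>e\<in>parcs G. 1)" by simp
  also have "\<dots> = (\<Sum>X\<in>uedges G. \<Sum>e\<in>{e \<in> parcs G. (case e of (u, v) \<Rightarrow> {u, v}) = X}. 1)"
    unfolding img by (rule sum.image_gen[OF pair_finite_arcs])
  also have "\<dots> = (\<Sum>X\<in>uedges G. 2)"
    by (rule sum.cong) (simp_all add: fib)
  finally show ?thesis by simp
qed

lemma card_uedges_conbhd:
  "2 * card (uedges G) + (\<Sum>v\<in>pverts G. card (conbhd G v)) = card (pverts G) * (card (pverts G) - 1)"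
proof -
  let ?nb = "\<lambda>v. {u \<in> pverts G. (v, u) \<in> parcs G}"
  have "parcs G = (SIGMA v:pverts G. ?nb v)"
    using wellformed' by auto
  also have "card \<dots> = (\<Sum>v\<in>pverts G. card (?nb v))"
    using pair_finite_verts by (intro card_SigmaI) simp_all
  finally have "card (parcs G) = (\<Sum>v\<in>pverts G. card (?nb v))" .
  then have "2 * card (uedges G) + (\<Sum>v\<in>pverts G. card (conbhd G v))
      = (\<Sum>v\<in>pverts G. card (?nb v) + card (conbhd G v))"
    using card_parcs by (simp add: sum.distrib)
  also have "\<dots> = (\<Sum>v\<in>pverts G. card (pverts G) - 1)"
  proof (rule sum.cong)
    fix v assume v: "v \<in> pverts G"
    have "?nb v \<union> conbhd G v = pverts G - {v}"
      using pair_no_loops by (fastforce simp: mem_conbhd)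
    moreover have "?nb v \<inter> conbhd G v = {}" by (auto simp: mem_conbhd)
    ultimately show "card (?nb v) + card (conbhd G v) = card (pverts G) - 1"
      using v pair_finite_verts finite_conbhd card_Un_disjoint[of "?nb v" "conbhd G v"] by simp
  qed simp
  finally show ?thesis by simp
qed

text \<open>
  A universal vertex would be a dominating set by itself, without any overdominated vertex.
\<close>

lemma conbhd_nonempty:
  assumes "2 \<le> gamma_CR G" "v \<in> pverts G"
  shows "conbhd G v \<noteq> {}"
proof
  assume e: "conbhd G v = {}"
  have nin: "v \<notin> conbhd G u" if "u \<in> pverts G" for u
    using conbhd_sym[OF _ that] e by blast
  have dom: "dominating G {v}"
    unfolding dominating_iff using assms nin by auto
  have "once_dominated G {v} = pverts G"
    unfolding once_dominated_def using nin by (auto simp: insert_Diff_if)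
  then have "CR_set G {v} = 0" using CR_set_add_once[OF dom] by simp
  then have "gamma_CR G \<le> card {v}" using CR_le[OF dom] by (intro gamma_CR_le[OF dom]) simp
  then show False using assms by simp
qed

lemma card_once_le:
  assumes "dominating G S"
  shows "card (once_dominated G S) \<le> card (pverts G) - CR G"
  using CR_le[OF assms] CR_set_add_once[OF assms] by linarith

lemma card_inter_once:
  assumes "dominating G S" "v \<in> once_dominated G S"
  shows "card (S \<inter> conbhd G v) = card S - 1"
  using assms(2) card_Diff_subset_Int[of S "conbhd G v"] dominatingD(2)[OF assms(1)]
    card_mono[of S "S \<inter> conbhd G v"]
  unfolding once_dominated_def by (auto simp: card_Diff_subset_Int)

text \<open>
  Let \<open>k = CR G\<close> and \<open>r = gamma_CR G\<close>. A smallest set \<open>S\<close> realising the redundancy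
  has \<open>r\<close> elements, and each of the \<open>n - k\<close> vertices
  dominated once has \<open>r - 1\<close> complement neighbours in \<open>S\<close>. This bounds the complement degrees on
  \<open>S\<close>; off \<open>S\<close> they are at least 1.
\<close>

lemma conbhd_sum_ge:
  assumes "2 \<le> gamma_CR G"
  shows "(card (pverts G) - CR G) * (gamma_CR G - 1) + (card (pverts G) - gamma_CR G)
          \<le> (\<Sum>v\<in>pverts G. card (conbhd G v))"
proof -
  obtain S where S: "dominating G S" "CR_set G S = CR G" "card S = gamma_CR G"
    using gamma_CR_attained .
  note SV = dominatingD(1,2)[OF S(1)]
  have once: "card (once_dominated G S) = card (pverts G) - CR G"
    using CR_set_add_once[OF S(1)] S(2) by linarith
  have sub: "once_dominated G S \<subseteq> pverts G" unfolding once_dominated_def by blast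
  have "(card (pverts G) - CR G) * (gamma_CR G - 1) = (\<Sum>v\<in>once_dominated G S. card (S \<inter> conbhd G v))"
    using card_inter_once[OF S(1)] once S(3) by simp
  also have "\<dots> \<le> (\<Sum>v\<in>pverts G. card (S \<inter> conbhd G v))"
    by (rule sum_mono2[OF pair_finite_verts sub]) simp
  also have "\<dots> = (\<Sum>v\<in>pverts G. \<Sum>s\<in>S. if s \<in> conbhd G v then 1 else 0)"
    using SV(2) by (intro sum.cong) (simp_all add: sum.If_cases)
  also have "\<dots> = (\<Sum>s\<in>S. \<Sum>v\<in>pverts G. if s \<in> conbhd G v then 1 else 0)"
    by (rule sum.swap)
  also have "\<dots> = (\<Sum>s\<in>S. card (conbhd G s))"
  proof (rule sum.cong)
    fix s assume s: "s \<in> S"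
    have "pverts G \<inter> {v. s \<in> conbhd G v} = conbhd G s"
      using conbhd_sym s SV(1) conbhd_subset by blast
    then show "(\<Sum>v\<in>pverts G. if s \<in> conbhd G v then 1 else 0) = card (conbhd G s)"
      using pair_finite_verts by (simp add: sum.If_cases)
  qed simp
  finally have 1: "(card (pverts G) - CR G) * (gamma_CR G - 1) \<le> (\<Sum>s\<in>S. card (conbhd G s))" .
  have "card (pverts G) - gamma_CR G = (\<Sum>v\<in>pverts G - S. 1)"
    using SV S(3) by (simp add: card_Diff_subset)
  also have "\<dots> \<le> (\<Sum>v\<in>pverts G - S. card (conbhd G v))"
    using conbhd_nonempty[OF assms] finite_conbhd
    by (intro sum_mono) (simp add: Suc_leI card_gt_0_iff)
  finally show ?thesis
    using 1 sum.subset_diff[OF SV(1) pair_finite_verts, of "\<lambda>v. card (conbhd G v)"] by linarith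
qed

text \<open>
  Two distinct vertices form a dominating set exactly if they have no common complement neighbour; a vertex is then
  dominated once if it is a complement neighbour of one of them.
\<close>

lemma pair_once:
  assumes "u \<in> pverts G" "v \<in> pverts G" "u \<noteq> v" "conbhd G u \<inter> conbhd G v = {}"
  shows "dominating G {u, v}"
    and "card (once_dominated G {u, v}) = card (conbhd G u) + card (conbhd G v)"
proof -
  have iff: "u \<in> conbhd G w \<longleftrightarrow> w \<in> conbhd G u" "v \<in> conbhd G w \<longleftrightarrow> w \<in> conbhd G v"
    if "w \<in> pverts G" for w
    using conbhd_sym that assms by blast+
  show "dominating G {u, v}"
    unfolding dominating_iff using assms iff by auto
  have "w \<in> once_dominated G {u, v} \<longleftrightarrow> w \<in> conbhd G u \<union> conbhd G v" for w
  proof (cases "w \<in> pverts G")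
    case True
    have "w \<notin> conbhd G u \<or> w \<notin> conbhd G v" using assms(4) by blast
    then show ?thesis
      using True assms(3) iff[OF True] unfolding once_dominated_def
      by (auto simp: insert_Diff_if)
  next
    case False
    then show ?thesis using conbhd_subset unfolding once_dominated_def by auto
  qed
  then have "once_dominated G {u, v} = conbhd G u \<union> conbhd G v" by blast
  then show "card (once_dominated G {u, v}) = card (conbhd G u) + card (conbhd G v)"
    using card_Un_disjoint[OF finite_conbhd finite_conbhd assms(4)] by simp
qed

lemma CR_gamma_eqI:
  assumes dom: "dominating G S" and card: "card S = 2" "card (once_dominated G S) = d"
    and le: "\<And>T. dominating G T \<Longrightarrow> card (once_dominated G T) \<le> d"
    and ne: "pverts G \<noteq> {}" "\<And>v. v \<in> pverts G \<Longrightarrow> conbhd G v \<noteq> {}"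
  shows "CR G = card (pverts G) - d" "gamma_CR G = 2"
proof -
  obtain T where T: "dominating G T" "CR_set G T = CR G" "card T = gamma_CR G"
    using gamma_CR_attained .
  have "CR_set G S \<le> CR_set G T"
    using CR_set_add_once[OF T(1)] CR_set_add_once[OF dom] le[OF T(1)] card by linarith
  then have eq: "CR_set G S = CR G" using CR_le[OF dom] T by linarith
  then show "CR G = card (pverts G) - d" using CR_set_add_once[OF dom] card by linarith
  have "card T \<noteq> 0" using dominatingD[OF T(1)] ne(1) by fastforce
  moreover have "card T \<noteq> 1"
  proof
    assume "card T = 1"
    then obtain x where x: "T = {x}" by (rule card_eq_1_obtain)
    then have "x \<in> pverts G" using dominatingD(1)[OF T(1)] by simp
    then obtain v where v: "v \<in> conbhd G x" using ne(2) by blast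
    then have "x \<in> conbhd G v" "v \<in> pverts G" using conbhd_sym \<open>x \<in> pverts G\<close> conbhd_subset by blast+
    then show False using dominatingD(3)[OF T(1)] x by blast
  qed
  ultimately have "2 \<le> gamma_CR G" using T(3) by linarith
  then show "gamma_CR G = 2" using gamma_CR_le[OF dom eq] card by linarith
qed

end

section \<open>Redundancy three less than the order\<close>

context pair_graph
begin

text \<open>
  The complement satisfies the assumptions of \<^locale>\<open>meeting_graph\<close>, and contains a scattered triple.
\<close>

lemma gamma_ge_3_imp_odd:
  assumes gamma: "3 \<le> gamma_CR G" and CR3: "card (pverts G) = CR G + 3"
  shows "odd (card (pverts G))"
proof -
  let ?V = "pverts G" and ?N = "conbhd G"
  have once3: "card (once_dominated G S) \<le> 3" if "dominating G S" for S
    using card_once_le[OF that] CR3 by simp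
  have ne: "?N v \<noteq> {}" if "v \<in> ?V" for v
    using conbhd_nonempty that gamma by simp
  have meet3: "?N u \<inter> ?N v \<noteq> {}"
    if uv: "u \<in> ?V" "v \<in> ?V" "u \<noteq> v" "3 \<le> card (?N u) + card (?N v)" for u v
  proof
    assume "?N u \<inter> ?N v = {}"
    note p = pair_once[OF uv(1-3) this]
    have "CR_set G {u, v} = CR G"
      using once3[OF p(1)] p(2) uv(4) CR_set_add_once[OF p(1)] CR3 by linarith
    then have "gamma_CR G \<le> card {u, v}" by (rule gamma_CR_le[OF p(1)])
    then show False using gamma uv(3) by simp
  qed
  \<comment> \<open>Some vertex has complement degree at least 2; it then forces this degree everywhere.\<close>
  obtain c where c: "c \<in> ?V" "2 \<le> card (?N c)"
  proof -
    obtain S where S: "dominating G S" "CR_set G S = CR G" "card S = gamma_CR G"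
      using gamma_CR_attained .
    have "card (once_dominated G S) = 3" using CR_set_add_once[OF S(1)] S(2) CR3 by linarith
    then have "once_dominated G S \<noteq> {}" by auto
    then obtain v where v: "v \<in> once_dominated G S" by blast
    have "2 \<le> card (S \<inter> ?N v)" using card_inter_once[OF S(1) v] S(3) gamma by simp
    also have "\<dots> \<le> card (?N v)" by (intro card_mono finite_conbhd) simp
    finally show thesis using v that unfolding once_dominated_def by blast
  qed
  have pos: "0 < card (?N v)" if "v \<in> ?V" for v
    using ne[OF that] finite_conbhd by (simp add: card_gt_0_iff)
  \<comment> \<open>If the only complement neighbour of \<open>y\<close> is \<open>z\<close>, then \<open>z\<close> is also joined to \<open>c\<close>. So \<open>y\<close> and \<open>z\<close> have a
     common complement neighbour, which can only be \<open>z\<close> itself.\<close>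
  have two: "2 \<le> card (?N y)" if y: "y \<in> ?V" for y
  proof (rule ccontr)
    assume "\<not> 2 \<le> card (?N y)"
    then have "card (?N y) = 1" using pos[OF y] by linarith
    then obtain z where z: "?N y = {z}" by (rule card_eq_1_obtain)
    have zV: "z \<in> ?V" and zy: "z \<noteq> y" and yz: "y \<in> ?N z"
      using conbhd_subset[of y] conbhd_irrefl[of y] conbhd_sym[of z y] z y by auto
    have cy: "c \<noteq> y" using c \<open>card (?N y) = 1\<close> by auto
    have "3 \<le> card (?N c) + card (?N y)" using c(2) pos[OF y] by linarith
    then have "z \<in> ?N c" using meet3[OF c(1) y cy] z by auto
    then have "{c, y} \<subseteq> ?N z" using conbhd_sym[OF _ c(1)] yz by blast
    then have "card {c, y} \<le> card (?N z)" by (rule card_mono[OF finite_conbhd])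
    then have "3 \<le> card (?N z) + card (?N y)" using cy pos[OF y] by simp
    then have "?N z \<inter> ?N y \<noteq> {}" using meet3[OF zV y zy] by blast
    then show False using z conbhd_irrefl by auto
  qed
  have meet: "?N u \<inter> ?N v \<noteq> {}" if "u \<in> ?V" "v \<in> ?V" "u \<noteq> v" for u v
    using meet3[OF that] two[OF that(1)] two[OF that(2)] by linarith
  have triple: "card (?N x \<inter> ?N y) = 1"
    if xyz: "x \<in> ?V" "y \<in> ?V" "z \<in> ?V" "x \<noteq> y" "y \<noteq> z" "x \<noteq> z" "?N x \<inter> ?N y \<inter> ?N z = {}" for x y z
  proof -
    have iff: "x \<in> ?N w \<longleftrightarrow> w \<in> ?N x" "y \<in> ?N w \<longleftrightarrow> w \<in> ?N y" "z \<in> ?N w \<longleftrightarrow> w \<in> ?N z"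
      if "w \<in> ?V" for w
      using conbhd_sym that xyz by blast+
    have dom: "dominating G {x, y, z}"
      unfolding dominating_iff using xyz iff by auto
    have sub: "w \<in> once_dominated G {x, y, z}"
      if w: "w \<in> (?N x \<inter> ?N y) \<union> ((?N y \<inter> ?N z) \<union> (?N x \<inter> ?N z))" for w
    proof -
      have wV: "w \<in> ?V" using w conbhd_subset by blast
      have "\<not> (w \<in> ?N x \<and> w \<in> ?N y \<and> w \<in> ?N z)" using xyz(7) by blast
      then have "card ({x, y, z} - ?N w) = 1"
        using w xyz(4-6) iff[OF wV] by (auto simp: insert_Diff_if)
      then show ?thesis using wV unfolding once_dominated_def by simp
    qed
    have "card (?N x \<inter> ?N y) + (card (?N y \<inter> ?N z) + card (?N x \<inter> ?N z))
        = card ((?N x \<inter> ?N y) \<union> ((?N y \<inter> ?N z) \<union> (?N x \<inter> ?N z)))"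
      using xyz(7) finite_conbhd
      by (subst card_Un_disjoint; (subst card_Un_disjoint)?) auto
    also have "\<dots> \<le> card (once_dominated G {x, y, z})"
      using sub by (intro card_mono finite_once_dominated) blast
    also have "\<dots> \<le> 3" by (rule once3[OF dom])
    finally have "card (?N x \<inter> ?N y) + (card (?N y \<inter> ?N z) + card (?N x \<inter> ?N z)) \<le> 3" .
    moreover have "0 < card (?N x \<inter> ?N y)" "0 < card (?N y \<inter> ?N z)" "0 < card (?N x \<inter> ?N z)"
      using meet xyz finite_conbhd by (simp_all add: card_gt_0_iff)
    ultimately show ?thesis by linarith
  qed
  interpret Q: meeting_graph ?V ?N
    using pair_finite_verts conbhd_subset conbhd_irrefl conbhd_sym meet triple
    by unfold_locales blast+
  \<comment> \<open>A smallest dominating set is a scattered triple: each of its elements is alone in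
     dominating some vertex, so there are at most three of them.\<close>
  obtain S where S: "dominating G S" and min: "\<And>T. dominating G T \<Longrightarrow> card S \<le> card T"
    using ex_has_least_nat[of "dominating G", OF dominating_verts, of card] by blast
  note SV = dominatingD(1,2)[OF S]
  have "\<exists>v\<in>?V. S - {x} \<subseteq> ?N v" if x: "x \<in> S" for x
  proof -
    have "card (S - {x}) < card S" by (rule card_Diff1_less[OF SV(2) x])
    then have "\<not> dominating G (S - {x})" using min by (meson not_less)
    then show ?thesis unfolding dominating_iff using SV(1) by blast
  qed
  then obtain w where w: "\<And>x. x \<in> S \<Longrightarrow> w x \<in> ?V" "\<And>x. x \<in> S \<Longrightarrow> S - {x} \<subseteq> ?N (w x)"
    by metis
  have w': "S - ?N (w x) = {x}" if "x \<in> S" for x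
  proof -
    have "x \<notin> ?N (w x)" using dominatingD(3)[OF S w(1)[OF that]] w(2)[OF that] by blast
    then show ?thesis using w(2)[OF that] that by blast
  qed
  have "card S = card (w ` S)"
    using w' by (intro card_image[symmetric] inj_onI) (metis singleton_inject)
  also have "\<dots> \<le> card (once_dominated G S)"
    using w(1) w' by (intro card_mono finite_once_dominated) (auto simp: once_dominated_def)
  also have "\<dots> \<le> 3" by (rule once3[OF S])
  finally have "card S \<le> 3" .
  moreover have "card S \<noteq> 0"
    using dominatingD[OF S] c(1) by auto
  moreover have "card S \<noteq> 1"
  proof
    assume "card S = 1"
    then obtain x where x: "S = {x}" by (rule card_eq_1_obtain)
    then have xV: "x \<in> ?V" using SV by simp
    then obtain v where v: "v \<in> ?N x" using ne by blast
    then have "x \<in> ?N v" "v \<in> ?V" using conbhd_sym xV conbhd_subset by blast+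
    then show False using dominatingD(3)[OF S] x by blast
  qed
  moreover have "card S \<noteq> 2"
  proof
    assume "card S = 2"
    then obtain x y where xy: "S = {x, y}" "x \<noteq> y" by (meson card_2_iff)
    then have V: "x \<in> ?V" "y \<in> ?V" using SV by auto
    then obtain v where v: "v \<in> ?N x" "v \<in> ?N y" using meet xy(2) by blast
    then have "x \<in> ?N v" "y \<in> ?N v" "v \<in> ?V" using conbhd_sym V conbhd_subset by blast+
    then show False using dominatingD(3)[OF S] xy by blast
  qed
  ultimately have "card S = 3" by linarith
  then obtain x y z where xyz: "S = {x, y, z}" "x \<noteq> y" "y \<noteq> z" "x \<noteq> z"
    by (metis card_3_iff)
  then have V: "x \<in> ?V" "y \<in> ?V" "z \<in> ?V" using SV by auto
  have "?N x \<inter> ?N y \<inter> ?N z = {}"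
  proof (rule ccontr)
    assume "?N x \<inter> ?N y \<inter> ?N z \<noteq> {}"
    then obtain v where v: "v \<in> ?N x" "v \<in> ?N y" "v \<in> ?N z" by blast
    then have "x \<in> ?N v" "y \<in> ?N v" "z \<in> ?N v" "v \<in> ?V" using conbhd_sym V conbhd_subset by blast+
    then show False using dominatingD(3)[OF S] xyz(1) by blast
  qed
  then have "Q.scattered x y z" unfolding Q.scattered_def using V xyz by blast
  then show ?thesis by (rule Q.scattered_imp_odd_card)
qed

end

section \<open>Extremal graphs with a two-element dominating set\<close>

text \<open>
  The graph on \<^term>\<open>{..<n}\<close> with the prescribed complement neighbourhoods.
\<close>

definition graph_of_conbhds :: "nat \<Rightarrow> (nat \<Rightarrow> nat set) \<Rightarrow> nat pair_pre_digraph" where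
  "graph_of_conbhds n N = \<lparr>pverts = {..<n}, parcs = {(u, v). u < n \<and> v < n \<and> u \<noteq> v \<and> v \<notin> N u}\<rparr>"

lemma graph_of_conbhds:
  assumes "\<And>v. v < n \<Longrightarrow> N v \<subseteq> {..<n} - {v}"
    and "\<And>u v. u < n \<Longrightarrow> v < n \<Longrightarrow> u \<in> N v \<Longrightarrow> v \<in> N u"
  shows "pair_graph (graph_of_conbhds n N)" "pverts (graph_of_conbhds n N) = {..<n}"
    and "v < n \<Longrightarrow> conbhd (graph_of_conbhds n N) v = N v"
proof -
  let ?A = "{(u, v). u < n \<and> v < n \<and> u \<noteq> v \<and> v \<notin> N u}"
  have "finite ?A" by (rule finite_subset[of _ "{..<n} \<times> {..<n}"]) auto
  then show "pair_graph (graph_of_conbhds n N)"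
    using assms(2) unfolding graph_of_conbhds_def
    by unfold_locales (auto simp: symmetric_def intro!: symI)
  show "pverts (graph_of_conbhds n N) = {..<n}" by (simp add: graph_of_conbhds_def)
  show "v < n \<Longrightarrow> conbhd (graph_of_conbhds n N) v = N v"
    using assms(1)[of v] unfolding conbhd_def closed_nbhd_def graph_of_conbhds_def by auto
qed

text \<open>
  The assumptions \<open>pair\<close> and \<open>big\<close> bound the number of vertices dominated once by
  dominating sets of size 2 and of larger size: a vertex dominated once by a set of size
  at least 3 has two or more complement neighbours in it.
\<close>

lemma graph_of_conbhds_in_M_graphs:
  assumes sub: "\<And>v. v < n \<Longrightarrow> N v \<subseteq> {..<n} - {v}"
    and sym: "\<And>u v. u < n \<Longrightarrow> v < n \<Longrightarrow> u \<in> N v \<Longrightarrow> v \<in> N u"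
    and ne: "\<And>v. v < n \<Longrightarrow> N v \<noteq> {}"
    and pair: "\<And>u v. u < n \<Longrightarrow> v < n \<Longrightarrow> u \<noteq> v \<Longrightarrow> card (N u) + card (N v) \<le> d"
    and big: "card {v. v < n \<and> 2 \<le> card (N v)} \<le> d"
    and wit: "a < n" "b < n" "a \<noteq> b" "N a \<inter> N b = {}" "card (N a) + card (N b) = d"
  shows "graph_of_conbhds n N \<in> M_graphs n (n - d) 2"
    and "2 * card (uedges (graph_of_conbhds n N)) + (\<Sum>v<n. card (N v)) = n * (n - 1)"
proof -
  define H where "H = graph_of_conbhds n N"
  interpret H: pair_graph H
    unfolding H_def by (rule graph_of_conbhds(1); fact sub sym)
  have V: "pverts H = {..<n}"
    unfolding H_def by (rule graph_of_conbhds(2); fact sub sym)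
  have con: "conbhd H v = N v" if "v < n" for v
    unfolding H_def by (rule graph_of_conbhds(3); fact sub sym that)
  have le: "card (once_dominated H T) \<le> d" if T: "dominating H T" for T
  proof (cases "3 \<le> card T")
    case True
    have "2 \<le> card (conbhd H v)" if "v \<in> once_dominated H T" for v
    proof -
      have "2 \<le> card (T \<inter> conbhd H v)" using H.card_inter_once[OF T that] True by simp
      also have "\<dots> \<le> card (conbhd H v)" by (intro card_mono H.finite_conbhd) simp
      finally show ?thesis .
    qed
    moreover have "v < n" if "v \<in> once_dominated H T" for v
      using that V unfolding once_dominated_def by simp
    ultimately have "once_dominated H T \<subseteq> {v. v < n \<and> 2 \<le> card (N v)}"
      using con by auto
    then have "card (once_dominated H T) \<le> card {v. v < n \<and> 2 \<le> card (N v)}"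
      by (intro card_mono) simp_all
    then show ?thesis using big by linarith
  next
    case False
    note TV = H.dominatingD(1,2)[OF T]
    have "card T \<noteq> 0" using H.dominatingD(3)[OF T, of a] TV V wit by auto
    moreover have "card T \<noteq> 1"
    proof
      assume "card T = 1"
      then obtain x where x: "T = {x}" by (rule card_eq_1_obtain)
      then have xV: "x < n" using TV V by simp
      then obtain v where v: "v \<in> N x" using ne by blast
      then have "v < n" using sub xV by blast
      then have "x \<in> conbhd H v" using con sym[OF _ xV v] by simp
      then show False using H.dominatingD(3)[OF T] x V \<open>v < n\<close> by blast
    qed
    ultimately have "card T = 2" using False by linarith
    then obtain x y where xy: "T = {x, y}" "x \<noteq> y" by (meson card_2_iff)
    then have xyV: "x < n" "y < n" using TV V by auto
    have "conbhd H x \<inter> conbhd H y = {}"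
    proof (rule ccontr)
      assume "conbhd H x \<inter> conbhd H y \<noteq> {}"
      then obtain v where "v \<in> conbhd H x" "v \<in> conbhd H y" by blast
      then have "T \<subseteq> conbhd H v" "v \<in> pverts H"
        using H.conbhd_sym xy xyV V H.conbhd_subset by blast+
      then show False using H.dominatingD(3)[OF T] by blast
    qed
    then show ?thesis using H.pair_once(2)[of x y] xy xyV V con pair by simp
  qed
  have ab: "a \<in> pverts H" "b \<in> pverts H" "conbhd H a \<inter> conbhd H b = {}"
    using wit V con by auto
  have "CR H = card (pverts H) - d" "gamma_CR H = 2"
    using H.CR_gamma_eqI[OF H.pair_once(1)[OF ab(1,2) wit(3) ab(3)], of d] le
      H.pair_once(2)[OF ab(1,2) wit(3) ab(3)] con wit V ne by auto
  then show "graph_of_conbhds n N \<in> M_graphs n (n - d) 2"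
    unfolding M_graphs_def using H.pair_graph V H_def by simp
  show "2 * card (uedges (graph_of_conbhds n N)) + (\<Sum>v<n. card (N v)) = n * (n - 1)"
    using H.card_uedges_conbhd V con unfolding H_def[symmetric] by simp
qed

text \<open>
  Complement neighbourhoods: a star with centre 0 and leaves \<open>1, \<dots>, d - 1\<close>, and the matching
  of \<open>d\<close> with \<open>d + 1\<close>, \<open>d + 2\<close> with \<open>d + 3\<close>, and so on.
\<close>

definition star_matching :: "nat \<Rightarrow> nat \<Rightarrow> nat set" where
  "star_matching d v =
     (if v = 0 then {1..<d} else if v < d then {0}
      else if even (v - d) then {v + 1} else {v - 1})"

text \<open>
  Complement neighbourhoods for the other parity: a star with centre 0 and leaves
  \<open>1, \<dots>, d - 2\<close>, extended by the edges from 1 to \<open>d - 1\<close> and from 2 to \<open>d\<close>,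
  and the matching of \<open>d + 1\<close> with \<open>d + 2\<close>, and so on. The vertices 1 and 2 have the common
  neighbour 0, and every pair of vertices has degree sum at most \<open>d\<close> if \<open>d \<ge> 4\<close>.
\<close>

definition spider_matching :: "nat \<Rightarrow> nat \<Rightarrow> nat set" where
  "spider_matching d v =
     (if v = 0 then {1..<d - 1} else if v = 1 then {0, d - 1} else if v = 2 then {0, d}
      else if v < d - 1 then {0} else if v = d - 1 then {1} else if v = d then {2}
      else if odd (v - d) then {v + 1} else {v - 1})"

lemma star_matching_graph:
  assumes d: "2 \<le> d" "d \<le> n" and par: "even (n - d)"
  shows "\<exists>H\<in>M_graphs n (n - d) 2. 2 * card (uedges H) + (n + d - 2) = n * (n - 1)"
proof -
  let ?N = "star_matching d"
  have card: "card (?N v) = (if v = 0 then d - 1 else 1)" for v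
    by (simp add: star_matching_def)
  have sub: "?N v \<subseteq> {..<n} - {v}" if "v < n" for v
  proof -
    have "v + 1 < n" if "\<not> v < d" "even (v - d)"
      using that \<open>v < n\<close> par d by presburger
    then show ?thesis using that d by (auto simp: star_matching_def)
  qed
  have sym: "v \<in> ?N u" if "u < n" "v < n" "u \<in> ?N v" for u v
    using that d by (auto simp: star_matching_def split: if_splits; presburger)
  have big: "card {v. v < n \<and> 2 \<le> card (?N v)} \<le> d"
  proof -
    have "{v. v < n \<and> 2 \<le> card (?N v)} \<subseteq> {0}" by (auto simp: card split: if_splits)
    then have "card {v. v < n \<and> 2 \<le> card (?N v)} \<le> card {0::nat}" by (intro card_mono) simp_all
    then show ?thesis using d by simp
  qed
  have ne: "?N v \<noteq> {}" for v using d by (auto simp: star_matching_def)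
  have pair: "card (?N u) + card (?N v) \<le> d" if "u \<noteq> v" for u v
    using that d by (auto simp: card)
  have wit: "?N 0 \<inter> ?N 1 = {}" "card (?N 0) + card (?N 1) = d"
    using d by (auto simp: card) (auto simp: star_matching_def)
  have "(\<Sum>v<n. card (?N v)) = (\<Sum>v<n. 1 + (if v = 0 then d - 2 else 0))"
    using d by (intro sum.cong) (auto simp: card)
  also have "\<dots> = n + d - 2" using d unfolding sum.distrib by simp
  finally have deg: "(\<Sum>v<n. card (?N v)) = n + d - 2" .
  have lt: "(0::nat) < n" "(1::nat) < n" "(0::nat) \<noteq> 1" using d by auto
  note * = graph_of_conbhds_in_M_graphs[of n ?N, OF sub sym ne pair big lt wit]
  show ?thesis using * deg by auto
qed

lemma spider_matching_graph:
  assumes d: "4 \<le> d" "d < n" and par: "odd (n - d)"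
  shows "\<exists>H\<in>M_graphs n (n - d) 2. 2 * card (uedges H) + (n + d - 1) = n * (n - 1)"
proof -
  let ?N = "spider_matching d"
  have card: "card (?N v) = (if v = 0 then d - 2 else if v \<le> 2 then 2 else 1)" for v
    using d by (auto simp: spider_matching_def)
  have sub: "?N v \<subseteq> {..<n} - {v}" if "v < n" for v
  proof -
    have "v + 1 < n" if "v > d" "odd (v - d)"
      using that \<open>v < n\<close> par d by presburger
    then show ?thesis using that d by (auto simp: spider_matching_def)
  qed
  have sym: "v \<in> ?N u" if "u < n" "v < n" "u \<in> ?N v" for u v
  proof -
    consider "v \<le> 2" | "2 < v" "v \<le> d" | "d < v" "odd (v - d)" | "d < v" "even (v - d)"
      by linarith
    then show ?thesis
    proof cases
      case 1
      then consider "v = 0" | "v = 1" | "v = 2" by linarith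
      then show ?thesis using that(3) d by cases (auto simp: spider_matching_def)
    next
      case 2
      then have "u = (if v < d - 1 then 0 else if v = d - 1 then 1 else 2)"
        using that(3) d by (auto simp: spider_matching_def split: if_splits)
      then show ?thesis using 2 d by (auto simp: spider_matching_def)
    next
      case 3
      then have "u = v + 1" using that(3) d by (auto simp: spider_matching_def split: if_splits)
      then show ?thesis using 3 d by (auto simp: spider_matching_def)
    next
      case 4
      then have "u = v - 1" using that(3) d by (auto simp: spider_matching_def split: if_splits)
      moreover have "d < v - 1" "odd (v - 1 - d)" using 4 by presburger+
      ultimately show ?thesis using d by (auto simp: spider_matching_def)
    qed
  qed
  have big: "card {v. v < n \<and> 2 \<le> card (?N v)} \<le> d"
  proof -
    have "{v. v < n \<and> 2 \<le> card (?N v)} \<subseteq> {..2}" by (auto simp: card split: if_splits)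
    then have "card {v. v < n \<and> 2 \<le> card (?N v)} \<le> card {..2::nat}" by (intro card_mono) simp_all
    then show ?thesis using d by simp
  qed
  have ne: "?N v \<noteq> {}" for v using d by (auto simp: spider_matching_def)
  have pair: "card (?N u) + card (?N v) \<le> d" if "u \<noteq> v" for u v
    using that d by (auto simp: card)
  have wit: "?N 0 \<inter> ?N 1 = {}" "card (?N 0) + card (?N 1) = d"
    using d by (auto simp: card) (auto simp: spider_matching_def)
  have "(\<Sum>v<n. card (?N v)) =
      (\<Sum>v<n. 1 + ((if v = 0 then d - 3 else 0) + ((if v = 1 then 1 else 0) + (if v = 2 then 1 else 0))))"
    using d by (intro sum.cong) (auto simp: card)
  also have "\<dots> = n + d - 1" using d unfolding sum.distrib by simp
  finally have deg: "(\<Sum>v<n. card (?N v)) = n + d - 1" .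
  have lt: "(0::nat) < n" "(1::nat) < n" "(0::nat) \<noteq> 1" using d by auto
  note * = graph_of_conbhds_in_M_graphs[of n ?N, OF sub sym ne pair big lt wit]
  show ?thesis using * deg by auto
qed

section \<open>Comparison of the edge counts\<close>

lemma finite_M_edges: "finite {card (uedges G) | G. G \<in> M_graphs n k r}"
proof -
  have "card (uedges G) \<le> n * (n - 1)" if "G \<in> M_graphs n k r" for G
    using that pair_graph.card_uedges_conbhd[of G] unfolding M_graphs_def by auto
  then have "{card (uedges G) | G. G \<in> M_graphs n k r} \<subseteq> {..n * (n - 1)}"
    by blast
  then show ?thesis by (rule finite_subset) simp
qed

lemma M_le_M:
  assumes "\<And>G. G \<in> M_graphs n k r \<Longrightarrow> \<exists>H\<in>M_graphs n k s. card (uedges G) \<le> card (uedges H)"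
  shows "M n k r \<le> M n k s"
proof (cases "M_graphs n k r = {}")
  case False
  then have "Max {card (uedges G) | G. G \<in> M_graphs n k r} \<in> {card (uedges G) | G. G \<in> M_graphs n k r}"
    by (intro Max_in finite_M_edges) auto
  then obtain G where G: "G \<in> M_graphs n k r" "M n k r = card (uedges G)"
    unfolding M_def using False by auto
  obtain H where H: "H \<in> M_graphs n k s" "card (uedges G) \<le> card (uedges H)"
    using assms[OF G(1)] by blast
  have "card (uedges H) \<le> Max {card (uedges G) | G. G \<in> M_graphs n k s}"
    using H by (intro Max_ge finite_M_edges) auto
  also have "\<dots> = M n k s" unfolding M_def using H by auto
  finally show ?thesis using G H by linarith
qed (simp add: M_def)

text \<open>
  The bound of \<open>conbhd_sum_ge\<close> is \<open>n - 1 + (n - k - 1) (r - 1)\<close>, used here with \<open>r - 1 \<ge> 2\<close>.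
\<close>

lemma conbhd_sum_ge_gamma_3:
  assumes G: "G \<in> M_graphs n k r" and r: "3 \<le> r" "r \<le> n" and k: "k \<le> n - 1" "1 \<le> n"
  shows "n - 1 + 2 * (n - k - 1) + 2 * card (uedges G) \<le> n * (n - 1)"
proof -
  have p: "pair_graph G" "card (pverts G) = n" "CR G = k" "gamma_CR G = r"
    using G unfolding M_graphs_def by auto
  interpret pair_graph G by (rule p(1))
  obtain e where e: "n - k = Suc e" using k by (cases "n - k") auto
  have "2 * e \<le> (r - 1) * e" using r by (intro mult_right_mono) simp_all
  moreover have "(n - k) * (r - 1) + (n - r) = (r - 1) * e + (n - 1)"
    using r unfolding e by (simp add: mult.commute)
  ultimately show ?thesis
    using conbhd_sum_ge card_uedges_conbhd r e unfolding p by linarith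
qed

theorem theorem5p3:
  fixes n k r :: nat
  assumes "n \<ge> 5"
    and "even n \<longrightarrow> k \<le> n - 2"
    and "odd n \<longrightarrow> k \<le> n - 3"
    and "2 \<le> r" and "r \<le> n"
  shows "M n k r \<le> M n k 2"
proof (rule M_le_M)
  fix G assume G: "G \<in> M_graphs n k r"
  show "\<exists>H\<in>M_graphs n k 2. card (uedges G) \<le> card (uedges H)"
  proof (cases "r = 2")
    case False
    then have r: "3 \<le> r" using assms by simp
    define d where "d = n - k"
    have d: "2 \<le> d" "d \<le> n" "n - d = k" and odd3: "odd n \<Longrightarrow> 3 \<le> d"
      using assms unfolding d_def by (cases "even n"; simp)+
    have bound: "n - 1 + 2 * (d - 1) + 2 * card (uedges G) \<le> n * (n - 1)"
      using conbhd_sum_ge_gamma_3[OF G r] assms d unfolding d_def by simp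
    have p: "pair_graph G" "card (pverts G) = n" "CR G = k" "gamma_CR G = r"
      using G unfolding M_graphs_def by auto
    have "3 \<le> d" if "odd (n - d)"
      using that d odd3 by presburger
    then consider (star) "even (n - d)" | (spider) "odd (n - d)" "4 \<le> d"
      | (bad) "odd (n - d)" "d = 3"
      by linarith
    then show ?thesis
    proof cases
      case star
      obtain H where "H \<in> M_graphs n k 2" "2 * card (uedges H) + (n + d - 2) = n * (n - 1)"
        using star_matching_graph[OF d(1,2) star] d(3) by blast
      then show ?thesis using bound d by (intro bexI[of _ H]) linarith+
    next
      case spider
      have "d < n" using spider(1) d(2) by (cases "d = n") simp_all
      then obtain H where "H \<in> M_graphs n k 2" "2 * card (uedges H) + (n + d - 1) = n * (n - 1)"
        using spider_matching_graph[OF spider(2) _ spider(1)] d(3) by blast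
      then show ?thesis using bound d by (intro bexI[of _ H]) linarith+
    next
      case bad
      have "odd n" using pair_graph.gamma_ge_3_imp_odd[OF p(1)] p r d bad d_def by simp
      then show ?thesis using bad d by simp
    qed
  qed (use G in blast)
qed

end
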